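(* Let $\Omega \subset \mathbb{R}^n$ be an open set, let $1 \le p < \infty$, and let $L^p(\Omega)$ be the linear space of (almost-everywhere equivalence classes of) real- or complex-valued $p$-integrable functions on $\Omega$ with respect to Lebesgue measure. Put $$\Gamma = \{(f,g) \in L^p(\Omega) \times L^p(\Omega) : f\cdot g \in L^p(\Omega)\},$$ where $f \cdot g$ denotes the pointwise (almost everywhere) product. Then the triple $(L^p(\Omega), \Gamma, \cdot)$, with the pointwise multiplication $\cdot : \Gamma \to L^p(\Omega)$, $(f,g) \mapsto f\cdot g$, partially defined on the linear space $L^p(\Omega)$, is a partial algebra.
   Context: A partial algebra is a triple $(A, \Gamma, \cdot)$ consisting of a linear space $A$ over $\mathbb{K}$ ($\mathbb{K} = \mathbb{R}$ or $\mathbb{C}$), a relation $\Gamma \subset A \times A$, and a partial multiplication $\cdot : \Gamma \to A$ (so that the product $x \cdot y \in A$ is defined exactly when $(x,y) \in \Gamma$), such that for all $x,y,z \in A$ and all scalars $\alpha,\beta \in \mathbb{K}$: (1) if $(x,y) \in \Gamma$ and $(x,z) \in \Gamma$, then $(x, \alpha y + \beta z) \in \Gamma$ and $x \cdot (\alpha y + \beta z) = \alpha (x \cdot y) + \beta (x \cdot z)$; (2) if $(y,x) \in \Gamma$ and $(z,x) \in \Gamma$, then $(\alpha y + \beta z, x) \in \Gamma$ and $(\alpha y + \beta z)\cdot x = \alpha (y \cdot x) + \beta (z \cdot x)$. No associativity is required. *)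

theory Defs
  imports
    "HOL-Analysis.Analysis"
    "HOL-Algebra.Module"
    "HOL-Algebra.Algebraic_Closure_Type"
begin

text \<open>
  A linear space over a field is a module in the sense of HOL-Algebra; the real and complex
  scalars are the rings \<^term>\<open>ring_of_type_algebra :: real ring\<close> and
  \<^term>\<open>ring_of_type_algebra :: complex ring\<close>. The qualified names are needed because Main
  has a locale \<^verbatim>\<open>module\<close> and a class \<^verbatim>\<open>field\<close> of its own.

  The partial multiplication \<open>m\<close> takes pairs; \<^verbatim>\<open>\<rightarrow>\<^sub>E\<close> makes it \<^term>\<open>undefined\<close> off \<open>\<Gamma>\<close>, so
  that \<open>\<Gamma>\<close> is its exact domain.
\<close>

locale partial_algebra =
  K: Ring.field K + A: Module.module K A
  for K :: "'k ring" and A :: "('k, 'a) module" +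
  fixes \<Gamma> :: "('a \<times> 'a) set"
    and m :: "'a \<times> 'a \<Rightarrow> 'a"
  assumes rel_subset: "\<Gamma> \<subseteq> carrier A \<times> carrier A"
    and mult_closed: "m \<in> \<Gamma> \<rightarrow>\<^sub>E carrier A"
    and linear_right:
      "\<And>x y z \<alpha> \<beta>. \<lbrakk>x \<in> carrier A; y \<in> carrier A; z \<in> carrier A;
          \<alpha> \<in> carrier K; \<beta> \<in> carrier K; (x, y) \<in> \<Gamma>; (x, z) \<in> \<Gamma>\<rbrakk>
        \<Longrightarrow> (x, \<alpha> \<odot>\<^bsub>A\<^esub> y \<oplus>\<^bsub>A\<^esub> \<beta> \<odot>\<^bsub>A\<^esub> z) \<in> \<Gamma> \<and>
            m (x, \<alpha> \<odot>\<^bsub>A\<^esub> y \<oplus>\<^bsub>A\<^esub> \<beta> \<odot>\<^bsub>A\<^esub> z) = \<alpha> \<odot>\<^bsub>A\<^esub> m (x, y) \<oplus>\<^bsub>A\<^esub> \<beta> \<odot>\<^bsub>A\<^esub> m (x, z)"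
    and linear_left:
      "\<And>x y z \<alpha> \<beta>. \<lbrakk>x \<in> carrier A; y \<in> carrier A; z \<in> carrier A;
          \<alpha> \<in> carrier K; \<beta> \<in> carrier K; (y, x) \<in> \<Gamma>; (z, x) \<in> \<Gamma>\<rbrakk>
        \<Longrightarrow> (\<alpha> \<odot>\<^bsub>A\<^esub> y \<oplus>\<^bsub>A\<^esub> \<beta> \<odot>\<^bsub>A\<^esub> z, x) \<in> \<Gamma> \<and>
            m (\<alpha> \<odot>\<^bsub>A\<^esub> y \<oplus>\<^bsub>A\<^esub> \<beta> \<odot>\<^bsub>A\<^esub> z, x) = \<alpha> \<odot>\<^bsub>A\<^esub> m (y, x) \<oplus>\<^bsub>A\<^esub> \<beta> \<odot>\<^bsub>A\<^esub> m (z, x)"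

definition p_integrable ::
    "'a measure \<Rightarrow> real \<Rightarrow> ('a \<Rightarrow> 'k::real_normed_field) \<Rightarrow> bool" where
  "p_integrable M p f \<longleftrightarrow>
     f \<in> borel_measurable M \<and> integrable M (\<lambda>x. norm (f x) powr p)"

text \<open>
  For \<open>M = lebesgue_on \<Omega>\<close> the values of a function outside \<open>\<Omega>\<close> are irrelevant both to
  measurability and to the AE quantifier, so total functions represent functions on \<open>\<Omega>\<close>.
\<close>

definition ae_class ::
    "'a measure \<Rightarrow> ('a \<Rightarrow> 'k::real_normed_field) \<Rightarrow> ('a \<Rightarrow> 'k) set" where
  "ae_class M f = {g \<in> borel_measurable M. AE x in M. g x = f x}"

text \<open>
  Operations on classes are unions over representatives. All the classes in such a union
  coincide, so that the union is the class of the result for any choice of representatives.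
\<close>

definition ae_add ::
    "'a measure \<Rightarrow> ('a \<Rightarrow> 'k::real_normed_field) set \<Rightarrow> ('a \<Rightarrow> 'k) set \<Rightarrow> ('a \<Rightarrow> 'k) set" where
  "ae_add M F G = (\<Union>f\<in>F. \<Union>g\<in>G. ae_class M (\<lambda>x. f x + g x))"

definition ae_scale ::
    "'a measure \<Rightarrow> 'k \<Rightarrow> ('a \<Rightarrow> 'k::real_normed_field) set \<Rightarrow> ('a \<Rightarrow> 'k) set" where
  "ae_scale M c F = (\<Union>f\<in>F. ae_class M (\<lambda>x. c * f x))"

definition ae_mult ::
    "'a measure \<Rightarrow> ('a \<Rightarrow> 'k::real_normed_field) set \<Rightarrow> ('a \<Rightarrow> 'k) set \<Rightarrow> ('a \<Rightarrow> 'k) set" where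
  "ae_mult M F G = (\<Union>f\<in>F. \<Union>g\<in>G. ae_class M (\<lambda>x. f x * g x))"

text \<open>
  Module records extend ring records; the fields \<open>mult\<close> and \<open>one\<close> play no role in a module.
\<close>

definition Lp_space ::
    "'a measure \<Rightarrow> real \<Rightarrow> ('k::real_normed_field, ('a \<Rightarrow> 'k) set) module" where
  "Lp_space M p =
     \<lparr>carrier = ae_class M ` {f. p_integrable M p f},
      mult = undefined, one = undefined,
      zero = ae_class M (\<lambda>_. 0), add = ae_add M, smult = ae_scale M\<rparr>"

definition Lp_rel ::
    "'a measure \<Rightarrow> real \<Rightarrow> (('a \<Rightarrow> 'k::real_normed_field) set \<times> ('a \<Rightarrow> 'k) set) set" where
  "Lp_rel M p = {(F, G) \<in> carrier (Lp_space M p) \<times> carrier (Lp_space M p).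
                   ae_mult M F G \<in> carrier (Lp_space M p)}"

definition Lp_mult ::
    "'a measure \<Rightarrow> real \<Rightarrow> ('a \<Rightarrow> 'k::real_normed_field) set \<times> ('a \<Rightarrow> 'k) set \<Rightarrow> ('a \<Rightarrow> 'k) set" where
  "Lp_mult M p = restrict (\<lambda>(F, G). ae_mult M F G) (Lp_rel M p)"

end

theory Submission
  imports Defs
begin

text \<open>Everything reduces to representatives. Sums, multiples and products respect a.e.
  equality, so the operations on classes are computed on any chosen functions
  (\<open>ae_add_class\<close>, \<open>ae_mult_class\<close>, \<open>ae_scale_class\<close>), and
  membership of a class in L^p can be tested on any measurable representative
  (\<open>ae_class_in_Lp_iff\<close>). L^p is closed under sums by the bound in
  \<open>norm_add_powr_le\<close>, and the module axioms become pointwise field identities.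

  For bilinearity, let fh and gh be p-integrable. Pointwise (af + bg)h = a(fh) + b(gh), and the
  right side is p-integrable because L^p is a linear space. This gives the domain condition and the
  product formula at once (\<open>Lp_mult_linear_left\<close>). Linearity in the other argument
  follows since the product and its domain are symmetric.\<close>

lemma p_integrable_cong_AE:
  assumes "p_integrable M p f" "g \<in> borel_measurable M" "AE x in M. g x = f x"
  shows "p_integrable M p g"
proof -
  have "integrable M (\<lambda>x. norm (g x) powr p) \<longleftrightarrow> integrable M (\<lambda>x. norm (f x) powr p)"
    using assms by (intro integrable_cong_AE) (auto simp: p_integrable_def elim: eventually_mono)
  then show ?thesis
    using assms by (simp add: p_integrable_def)
qed

text \<open>True for every real \<open>p\<close>, as \<open>0 powr p\<close> is 0 by convention,
  even for \<open>p = 0\<close>.\<close>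

lemma p_integrable_zero: "p_integrable M p (\<lambda>_. 0)"
  by (simp add: p_integrable_def)

text \<open>Second countability of the scalars makes products (and below, sums) of Borel measurable
  functions measurable.\<close>

lemma p_integrable_scale:
  fixes f :: "'a \<Rightarrow> 'k::{real_normed_field, second_countable_topology}"
  assumes "p_integrable M p f"
  shows "p_integrable M p (\<lambda>x. c * f x)"
  using assms by (auto simp: p_integrable_def norm_mult powr_mult)

text \<open>The norm of a sum is at most twice the larger norm, and the p-th power of the larger
  norm is one of the two summands on the right. The constant is crude, but only finiteness of the
  integral is at stake.\<close>

lemma norm_add_powr_le:
  fixes a b :: "'a::real_normed_vector"
  assumes "0 \<le> p"
  shows "norm (a + b) powr p \<le> 2 powr p * (norm a powr p + norm b powr p)"
proof -
  have "norm (a + b) \<le> 2 * max (norm a) (norm b)"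
    using norm_triangle_ineq[of a b] by linarith
  then have "norm (a + b) powr p \<le> (2 * max (norm a) (norm b)) powr p"
    using assms by (intro powr_mono2) auto
  also have "\<dots> = 2 powr p * max (norm a) (norm b) powr p"
    by (simp add: powr_mult max_def)
  also have "\<dots> \<le> 2 powr p * (norm a powr p + norm b powr p)"
    by (intro mult_left_mono) (auto simp: max_def)
  finally show ?thesis .
qed

lemma p_integrable_add:
  fixes f g :: "'a \<Rightarrow> 'k::{real_normed_field, second_countable_topology}"
  assumes "0 \<le> p" "p_integrable M p f" "p_integrable M p g"
  shows "p_integrable M p (\<lambda>x. f x + g x)"
proof -
  have [measurable]: "f \<in> borel_measurable M" "g \<in> borel_measurable M"
    using assms by (auto simp: p_integrable_def)
  have "integrable M (\<lambda>x. norm (f x + g x) powr p)"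
  proof (rule Bochner_Integration.integrable_bound)
    show "integrable M (\<lambda>x. 2 powr p * (norm (f x) powr p + norm (g x) powr p))"
      using assms by (auto simp: p_integrable_def)
    show "AE x in M. norm (norm (f x + g x) powr p)
        \<le> norm (2 powr p * (norm (f x) powr p + norm (g x) powr p))"
      using norm_add_powr_le[OF assms(1)] by (intro AE_I2) simp
  qed measurable
  then show ?thesis
    by (simp add: p_integrable_def)
qed

lemma mem_ae_class: "g \<in> ae_class M f \<longleftrightarrow> g \<in> borel_measurable M \<and> (AE x in M. g x = f x)"
  by (simp add: ae_class_def)

lemma ae_class_self: "f \<in> borel_measurable M \<Longrightarrow> f \<in> ae_class M f"
  by (simp add: ae_class_def)

lemma ae_class_cong:
  assumes "AE x in M. f x = g x"
  shows "ae_class M f = ae_class M g"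
proof -
  have "(AE x in M. h x = f x) \<longleftrightarrow> (AE x in M. h x = g x)" for h
    using assms by (intro eventually_cong) auto
  then show ?thesis
    by (simp add: ae_class_def)
qed

text \<open>Independence of the representatives: all sets in the union defining
  \<open>ae_add\<close> are equal, so the union collapses to any one of them.\<close>

lemma ae_add_class:
  assumes "f \<in> borel_measurable M" "g \<in> borel_measurable M"
  shows "ae_add M (ae_class M f) (ae_class M g) = ae_class M (\<lambda>x. f x + g x)"
proof -
  have "ae_class M (\<lambda>x. f' x + g' x) = ae_class M (\<lambda>x. f x + g x)"
    if "f' \<in> ae_class M f" "g' \<in> ae_class M g" for f' g'
  proof (rule ae_class_cong)
    have "AE x in M. f' x = f x" "AE x in M. g' x = g x"
      using that by (simp_all add: mem_ae_class)
    then show "AE x in M. f' x + g' x = f x + g x"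
      by eventually_elim simp
  qed
  then show ?thesis
    \<comment> \<open>Measurability puts \<open>f\<close> and \<open>g\<close> into their own
      classes, so the union runs over a nonempty index set.\<close>
    unfolding ae_add_def using ae_class_self[OF assms(1)] ae_class_self[OF assms(2)]
    by (intro SUP_eq_const) blast+
qed

lemma ae_mult_class:
  assumes "f \<in> borel_measurable M" "g \<in> borel_measurable M"
  shows "ae_mult M (ae_class M f) (ae_class M g) = ae_class M (\<lambda>x. f x * g x)"
proof -
  have "ae_class M (\<lambda>x. f' x * g' x) = ae_class M (\<lambda>x. f x * g x)"
    if "f' \<in> ae_class M f" "g' \<in> ae_class M g" for f' g'
  proof (rule ae_class_cong)
    have "AE x in M. f' x = f x" "AE x in M. g' x = g x"
      using that by (simp_all add: mem_ae_class)
    then show "AE x in M. f' x * g' x = f x * g x"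
      by eventually_elim simp
  qed
  then show ?thesis
    unfolding ae_mult_def using ae_class_self[OF assms(1)] ae_class_self[OF assms(2)]
    by (intro SUP_eq_const) blast+
qed

lemma ae_scale_class:
  assumes "f \<in> borel_measurable M"
  shows "ae_scale M c (ae_class M f) = ae_class M (\<lambda>x. c * f x)"
proof -
  have "ae_class M (\<lambda>x. c * f' x) = ae_class M (\<lambda>x. c * f x)" if "f' \<in> ae_class M f" for f'
    using that by (intro ae_class_cong) (auto simp: mem_ae_class elim: eventually_mono)
  then show ?thesis
    unfolding ae_scale_def using ae_class_self[OF assms] by (intro SUP_eq_const) blast+
qed

text \<open>Membership in the carrier only provides some p-integrable function with the same class;
  p-integrability passes from it to \<open>f\<close> by a.e. equality.\<close>

lemma ae_class_in_Lp_iff: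
  assumes "f \<in> borel_measurable M"
  shows "ae_class M f \<in> carrier (Lp_space M p) \<longleftrightarrow> p_integrable M p f"
proof
  assume "ae_class M f \<in> carrier (Lp_space M p)"
  then obtain g where g: "p_integrable M p g" "ae_class M f = ae_class M g"
    by (auto simp: Lp_space_def)
  then have "f \<in> ae_class M g"
    using ae_class_self[OF assms] by simp
  then show "p_integrable M p f"
    using g p_integrable_cong_AE by (auto simp: mem_ae_class)
qed (auto simp: Lp_space_def)

lemma Lp_space_simps:
  "zero (Lp_space M p) = ae_class M (\<lambda>_. 0)"
  "add (Lp_space M p) = ae_add M"
  "smult (Lp_space M p) = ae_scale M"
  by (simp_all add: Lp_space_def)

lemma Lp_carrierE:
  assumes "F \<in> carrier (Lp_space M p)"
  obtains f where "f \<in> borel_measurable M" "p_integrable M p f" "F = ae_class M f"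
  using assms by (auto simp: Lp_space_def p_integrable_def)

lemma Lp_rel_class_iff:
  fixes f g :: "'a \<Rightarrow> 'k::{real_normed_field, second_countable_topology}"
  assumes [measurable]: "f \<in> borel_measurable M" "g \<in> borel_measurable M"
  shows "(ae_class M f, ae_class M g) \<in> Lp_rel M p \<longleftrightarrow>
    p_integrable M p f \<and> p_integrable M p g \<and> p_integrable M p (\<lambda>x. f x * g x)"
  by (simp add: Lp_rel_def ae_mult_class ae_class_in_Lp_iff)

lemma module_Lp_space:
  fixes M :: "'a measure"
  assumes p: "0 \<le> p"
  shows "Module.module (ring_of_type_algebra :: 'k::{real_normed_field, second_countable_topology} ring)
    (Lp_space M p)"
proof (intro moduleI abelian_groupI cring_from_type_algebra)
  fix F G H :: "('a \<Rightarrow> 'k) set" and a b :: 'k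
  assume F: "F \<in> carrier (Lp_space M p)"
  then obtain f where f: "f \<in> borel_measurable M" "p_integrable M p f" "F = ae_class M f"
    by (rule Lp_carrierE)
  note [measurable] = f(1)
  show "\<zero>\<^bsub>Lp_space M p\<^esub> \<oplus>\<^bsub>Lp_space M p\<^esub> F = F"
    by (simp add: f Lp_space_simps ae_add_class)
  show "\<exists>G \<in> carrier (Lp_space M p). G \<oplus>\<^bsub>Lp_space M p\<^esub> F = \<zero>\<^bsub>Lp_space M p\<^esub>"
  proof
    \<comment> \<open>The negative is written as the multiple by -1 so that closure under scaling
      applies to it.\<close>
    show "ae_class M (\<lambda>x. - 1 * f x) \<in> carrier (Lp_space M p)"
      using p_integrable_scale[OF f(2)] by (subst ae_class_in_Lp_iff) (measurable, blast)
    show "ae_class M (\<lambda>x. - 1 * f x) \<oplus>\<^bsub>Lp_space M p\<^esub> F = \<zero>\<^bsub>Lp_space M p\<^esub>"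
      by (simp add: f Lp_space_simps ae_add_class)
  qed
  show "a \<odot>\<^bsub>Lp_space M p\<^esub> F \<in> carrier (Lp_space M p)"
    using p_integrable_scale[OF f(2)]
    by (simp add: f Lp_space_simps ae_scale_class ae_class_in_Lp_iff)
  show "(a \<oplus>\<^bsub>ring_of_type_algebra\<^esub> b) \<odot>\<^bsub>Lp_space M p\<^esub> F
      = a \<odot>\<^bsub>Lp_space M p\<^esub> F \<oplus>\<^bsub>Lp_space M p\<^esub> b \<odot>\<^bsub>Lp_space M p\<^esub> F"
    by (simp add: f Lp_space_simps ae_scale_class ae_add_class ring_of_type_algebra_def
        distrib_right)
  show "(a \<otimes>\<^bsub>ring_of_type_algebra\<^esub> b) \<odot>\<^bsub>Lp_space M p\<^esub> F
      = a \<odot>\<^bsub>Lp_space M p\<^esub> (b \<odot>\<^bsub>Lp_space M p\<^esub> F)"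
    by (simp add: f Lp_space_simps ae_scale_class ring_of_type_algebra_def mult.assoc)
  show "\<one>\<^bsub>ring_of_type_algebra\<^esub> \<odot>\<^bsub>Lp_space M p\<^esub> F = F"
    by (simp add: f Lp_space_simps ae_scale_class ring_of_type_algebra_def)
  \<comment> \<open>The axioms above concern a single vector; a second and later a third are
    introduced only for the axioms that mention them.\<close>
  assume "G \<in> carrier (Lp_space M p)"
  then obtain g where g: "g \<in> borel_measurable M" "p_integrable M p g" "G = ae_class M g"
    by (rule Lp_carrierE)
  note [measurable] = g(1)
  show "F \<oplus>\<^bsub>Lp_space M p\<^esub> G \<in> carrier (Lp_space M p)"
    using p_integrable_add[OF p f(2) g(2)]
    by (simp add: f g Lp_space_simps ae_add_class ae_class_in_Lp_iff)
  show "F \<oplus>\<^bsub>Lp_space M p\<^esub> G = G \<oplus>\<^bsub>Lp_space M p\<^esub> F"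
    by (simp add: f g Lp_space_simps ae_add_class add.commute)
  show "a \<odot>\<^bsub>Lp_space M p\<^esub> (F \<oplus>\<^bsub>Lp_space M p\<^esub> G)
      = a \<odot>\<^bsub>Lp_space M p\<^esub> F \<oplus>\<^bsub>Lp_space M p\<^esub> a \<odot>\<^bsub>Lp_space M p\<^esub> G"
    by (simp add: f g Lp_space_simps ae_scale_class ae_add_class distrib_left)
  assume "H \<in> carrier (Lp_space M p)"
  then obtain h where h: "h \<in> borel_measurable M" "p_integrable M p h" "H = ae_class M h"
    by (rule Lp_carrierE)
  note [measurable] = h(1)
  show "F \<oplus>\<^bsub>Lp_space M p\<^esub> G \<oplus>\<^bsub>Lp_space M p\<^esub> H
      = F \<oplus>\<^bsub>Lp_space M p\<^esub> (G \<oplus>\<^bsub>Lp_space M p\<^esub> H)"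
    by (simp add: f g h Lp_space_simps ae_add_class add.assoc)
next
  show "\<zero>\<^bsub>Lp_space M p\<^esub> \<in> carrier (Lp_space M p)"
    by (simp add: Lp_space_simps ae_class_in_Lp_iff p_integrable_zero)
qed

lemma Lp_rel_carrier:
  assumes "(F, G) \<in> Lp_rel M p"
  shows "F \<in> carrier (Lp_space M p)" "G \<in> carrier (Lp_space M p)"
  using assms by (auto simp: Lp_rel_def)

lemma ae_mult_commute:
  fixes F G :: "('a \<Rightarrow> 'k::real_normed_field) set"
  shows "ae_mult M F G = ae_mult M G F"
  unfolding ae_mult_def by (subst SUP_commute) (simp add: mult.commute)

lemma Lp_rel_commute: "(F, G) \<in> Lp_rel M p \<longleftrightarrow> (G, F) \<in> Lp_rel M p"
  by (auto simp: Lp_rel_def ae_mult_commute)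

text \<open>Also valid off the domain: by symmetry of \<open>Lp_rel\<close> both sides are then
  \<open>undefined\<close>.\<close>

lemma Lp_mult_commute: "Lp_mult M p (F, G) = Lp_mult M p (G, F)"
  using Lp_rel_commute[of F G M p] by (simp add: Lp_mult_def restrict_def ae_mult_commute)

text \<open>The core of the argument: distributivity at each point, combined with linearity of L^p
  applied to the two products that are p-integrable by hypothesis.\<close>

lemma Lp_mult_linear_left:
  fixes F G H :: "('a \<Rightarrow> 'k::{real_normed_field, second_countable_topology}) set" and a b :: 'k
  assumes p: "0 \<le> p" and FH: "(F, H) \<in> Lp_rel M p" and GH: "(G, H) \<in> Lp_rel M p"
  defines "L \<equiv> a \<odot>\<^bsub>Lp_space M p\<^esub> F \<oplus>\<^bsub>Lp_space M p\<^esub> b \<odot>\<^bsub>Lp_space M p\<^esub> G"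
  shows "(L, H) \<in> Lp_rel M p \<and> Lp_mult M p (L, H) =
    a \<odot>\<^bsub>Lp_space M p\<^esub> Lp_mult M p (F, H) \<oplus>\<^bsub>Lp_space M p\<^esub> b \<odot>\<^bsub>Lp_space M p\<^esub> Lp_mult M p (G, H)"
proof -
  obtain f where f: "f \<in> borel_measurable M" "p_integrable M p f" "F = ae_class M f"
    using Lp_rel_carrier[OF FH] by (elim Lp_carrierE)
  obtain g where g: "g \<in> borel_measurable M" "p_integrable M p g" "G = ae_class M g"
    using Lp_rel_carrier[OF GH] by (elim Lp_carrierE)
  obtain h where h: "h \<in> borel_measurable M" "p_integrable M p h" "H = ae_class M h"
    using Lp_rel_carrier[OF GH] by (elim Lp_carrierE)
  note [measurable] = f(1) g(1) h(1)
  have fh: "p_integrable M p (\<lambda>x. f x * h x)" and gh: "p_integrable M p (\<lambda>x. g x * h x)"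
    using FH GH by (simp_all add: f g h Lp_rel_class_iff)
  have L: "L = ae_class M (\<lambda>x. a * f x + b * g x)"
    by (simp add: L_def f g Lp_space_simps ae_scale_class ae_add_class)
  have distr: "(\<lambda>x. (a * f x + b * g x) * h x) = (\<lambda>x. a * (f x * h x) + b * (g x * h x))"
    by (simp add: algebra_simps)
  have LH: "(L, H) \<in> Lp_rel M p"
    by (simp add: L h Lp_rel_class_iff distr p_integrable_add p_integrable_scale p f g fh gh)
  \<comment> \<open>The formula is first proved for the unrestricted product; \<open>Lp_mult\<close>
    agrees with it on the three pairs involved, since all of them lie in
    \<open>Lp_rel\<close>.\<close>
  moreover have "ae_mult M L H = ae_add M (ae_scale M a (ae_mult M F H)) (ae_scale M b (ae_mult M G H))"
    by (simp add: L f g h ae_mult_class ae_scale_class ae_add_class distr)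
  ultimately show ?thesis
    using FH GH by (simp add: Lp_mult_def Lp_space_simps)
qed

lemma partial_algebra_Lp_space:
  fixes M :: "'a measure"
  assumes p: "0 \<le> p"
  shows "partial_algebra (ring_of_type_algebra :: 'k::{real_normed_field, second_countable_topology} ring)
    (Lp_space M p) (Lp_rel M p) (Lp_mult M p)"
proof (intro partial_algebra.intro partial_algebra_axioms.intro field_from_type_algebra
    module_Lp_space p)
  show "Lp_rel M p \<subseteq> carrier (Lp_space M p) \<times> carrier (Lp_space M p)"
    by (auto simp: Lp_rel_def)
  show "Lp_mult M p \<in> Lp_rel M p \<rightarrow>\<^sub>E carrier (Lp_space M p)"
    by (auto simp: Lp_mult_def Lp_rel_def)
next
  fix F G H :: "('a \<Rightarrow> 'k) set" and a b :: 'k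
  let ?L = "a \<odot>\<^bsub>Lp_space M p\<^esub> G \<oplus>\<^bsub>Lp_space M p\<^esub> b \<odot>\<^bsub>Lp_space M p\<^esub> H"
  show "(?L, F) \<in> Lp_rel M p \<and> Lp_mult M p (?L, F) = a \<odot>\<^bsub>Lp_space M p\<^esub> Lp_mult M p (G, F)
      \<oplus>\<^bsub>Lp_space M p\<^esub> b \<odot>\<^bsub>Lp_space M p\<^esub> Lp_mult M p (H, F)"
    if "(G, F) \<in> Lp_rel M p" "(H, F) \<in> Lp_rel M p"
    using Lp_mult_linear_left[OF p that] .
  show "(F, ?L) \<in> Lp_rel M p \<and> Lp_mult M p (F, ?L) = a \<odot>\<^bsub>Lp_space M p\<^esub> Lp_mult M p (F, G)
      \<oplus>\<^bsub>Lp_space M p\<^esub> b \<odot>\<^bsub>Lp_space M p\<^esub> Lp_mult M p (F, H)"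
    if "(F, G) \<in> Lp_rel M p" "(F, H) \<in> Lp_rel M p"
    \<comment> \<open>Right linearity is left linearity with every pair swapped. Fixing
      \<open>F\<close> as the first component in the commutation rules orients the
      rewriting.\<close>
    using Lp_mult_linear_left[OF p, of G F M H a b] that
    by (simp add: Lp_rel_commute[of F] Lp_mult_commute[of M p F])
qed

theorem proposition1p7:
  fixes \<Omega> :: "(real ^ 'n) set" and p :: real
  assumes "open \<Omega>" and "1 \<le> p"
  shows "partial_algebra (ring_of_type_algebra :: real ring)
           (Lp_space (lebesgue_on \<Omega>) p) (Lp_rel (lebesgue_on \<Omega>) p) (Lp_mult (lebesgue_on \<Omega>) p) \<and>
         partial_algebra (ring_of_type_algebra :: complex ring)
           (Lp_space (lebesgue_on \<Omega>) p) (Lp_rel (lebesgue_on \<Omega>) p) (Lp_mult (lebesgue_on \<Omega>) p)"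
  \<comment> \<open>The reals and the complex numbers are both second countable real normed fields,
    so the general result is instantiated twice.\<close>
  using assms by (simp add: partial_algebra_Lp_space)

end
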